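(* Let $(\mathscr{A},\mathscr{E})$ be an exact category. Let $A\xrightarrow{u}B\xrightarrow{q}X$, $A\xrightarrow{w}C\xrightarrow{r}Y$ and $B\xrightarrow{v}C\xrightarrow{t}Z$ be short exact sequences with $w=vu$. Then there exist morphisms $x:X\to Y$ and $y:Y\to Z$ such that the diagram $$\begin{array}{ccccc} A & \xrightarrow{u} & B & \xrightarrow{q} & X\\ {\scriptstyle 1_A}\downarrow & & {\scriptstyle v}\downarrow & & {\scriptstyle x}\downarrow\\ A & \xrightarrow{w} & C & \xrightarrow{r} & Y\\ & & {\scriptstyle t}\downarrow & & {\scriptstyle y}\downarrow\\ & & Z & \xrightarrow{1_Z} & Z\end{array}$$ is commutative; they are uniquely determined by this requirement, and $X\xrightarrow{x}Y\xrightarrow{y}Z$ is short exact. Moreover, the upper right hand square (with vertices $B,X,C,Y$) is bicartesian, i.e. both a push-out and a pull-back.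
   Context: A kernel-cokernel pair in an additive category $\mathscr{A}$ is a pair of composable morphisms $A'\xrightarrow{i}A\xrightarrow{p}A''$ such that $i$ is a kernel of $p$ and $p$ is a cokernel of $i$. Given a class $\mathscr{E}$ of kernel-cokernel pairs, an admissible monic is a morphism $i$ for which there is $p$ with $(i,p)\in\mathscr{E}$; an admissible epic is a morphism $p$ for which there is $i$ with $(i,p)\in\mathscr{E}$. An exact structure on $\mathscr{A}$ is a class $\mathscr{E}$ of kernel-cokernel pairs closed under isomorphisms such that: all identity morphisms are admissible monics and admissible epics; admissible monics are closed under composition and admissible epics are closed under composition; the push-out of an admissible monic along an arbitrary morphism exists and yields an admissible monic; the pull-back of an admissible epic along an arbitrary morphism exists and yields an admissible epic. An exact category is a pair $(\mathscr{A},\mathscr{E})$ of an additive category and an exact structure on it; elements of $\mathscr{E}$ are called short exact sequences. *)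

theory Defs
  imports "HOL-Algebra.Group"
begin

record ('o, 'm) cat =
  Obj :: "'o set"
  Arr :: "'m set"
  Dom :: "'m \<Rightarrow> 'o"
  Cod :: "'m \<Rightarrow> 'o"
  Ident :: "'o \<Rightarrow> 'm"
  Comp :: "'m \<Rightarrow> 'm \<Rightarrow> 'm"  (infixl \<open>\<cdot>\<index>\<close> 70)

text \<open>Composition is written in the usual order: \<open>g \<cdot>\<^bsub>\<A>\<^esub> f\<close> is \<open>f\<close> followed by \<open>g\<close>.\<close>

definition homset :: "('o, 'm, 'z) cat_scheme \<Rightarrow> 'o \<Rightarrow> 'o \<Rightarrow> 'm set" where
  "homset \<A> A B = {f \<in> Arr \<A>. Dom \<A> f = A \<and> Cod \<A> f = B}"

locale category =
  fixes \<A> :: "('o, 'm, 'z) cat_scheme" (structure)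
  assumes Dom_Obj: "f \<in> Arr \<A> \<Longrightarrow> Dom \<A> f \<in> Obj \<A>"
    and Cod_Obj: "f \<in> Arr \<A> \<Longrightarrow> Cod \<A> f \<in> Obj \<A>"
    and Ident_hom: "A \<in> Obj \<A> \<Longrightarrow> Ident \<A> A \<in> homset \<A> A A"
    and Comp_hom: "f \<in> homset \<A> A B \<Longrightarrow> g \<in> homset \<A> B C \<Longrightarrow> g \<cdot> f \<in> homset \<A> A C"
    and Comp_Ident: "f \<in> homset \<A> A B \<Longrightarrow> f \<cdot> Ident \<A> A = f"
    and Ident_Comp: "f \<in> homset \<A> A B \<Longrightarrow> Ident \<A> B \<cdot> f = f"
    and Comp_assoc: "f \<in> homset \<A> A B \<Longrightarrow> g \<in> homset \<A> B C \<Longrightarrow> h \<in> homset \<A> C D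
      \<Longrightarrow> (h \<cdot> g) \<cdot> f = h \<cdot> (g \<cdot> f)"

definition isomorphism :: "('o, 'm, 'z) cat_scheme \<Rightarrow> 'm \<Rightarrow> bool" where
  "isomorphism \<A> f \<longleftrightarrow> f \<in> Arr \<A> \<and>
    (\<exists>g \<in> homset \<A> (Cod \<A> f) (Dom \<A> f).
      g \<cdot>\<^bsub>\<A>\<^esub> f = Ident \<A> (Dom \<A> f) \<and> f \<cdot>\<^bsub>\<A>\<^esub> g = Ident \<A> (Cod \<A> f))"

text \<open>
  The predicates on squares below all take the four sides in the order \<open>a b c d\<close>, where
  \<open>a : P \<rightarrow> Q\<close> and \<open>b : P \<rightarrow> R\<close> leave one corner, \<open>c : Q \<rightarrow> S\<close> and \<open>d : R \<rightarrow> S\<close> enter the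
  opposite corner, and \<open>c \<cdot> a = d \<cdot> b\<close>.
\<close>

definition commutative_square :: "('o, 'm, 'z) cat_scheme \<Rightarrow> 'm \<Rightarrow> 'm \<Rightarrow> 'm \<Rightarrow> 'm \<Rightarrow> bool" where
  "commutative_square \<A> a b c d \<longleftrightarrow>
    a \<in> Arr \<A> \<and> b \<in> Arr \<A> \<and> c \<in> Arr \<A> \<and> d \<in> Arr \<A> \<and>
    Dom \<A> a = Dom \<A> b \<and> Cod \<A> a = Dom \<A> c \<and> Cod \<A> b = Dom \<A> d \<and> Cod \<A> c = Cod \<A> d \<and>
    c \<cdot>\<^bsub>\<A>\<^esub> a = d \<cdot>\<^bsub>\<A>\<^esub> b"

definition is_pushout :: "('o, 'm, 'z) cat_scheme \<Rightarrow> 'm \<Rightarrow> 'm \<Rightarrow> 'm \<Rightarrow> 'm \<Rightarrow> bool" where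
  "is_pushout \<A> a b c d \<longleftrightarrow> commutative_square \<A> a b c d \<and>
    (\<forall>g h. commutative_square \<A> a b g h \<longrightarrow>
      (\<exists>!k. k \<in> homset \<A> (Cod \<A> c) (Cod \<A> g) \<and> k \<cdot>\<^bsub>\<A>\<^esub> c = g \<and> k \<cdot>\<^bsub>\<A>\<^esub> d = h))"

definition is_pullback :: "('o, 'm, 'z) cat_scheme \<Rightarrow> 'm \<Rightarrow> 'm \<Rightarrow> 'm \<Rightarrow> 'm \<Rightarrow> bool" where
  "is_pullback \<A> a b c d \<longleftrightarrow> commutative_square \<A> a b c d \<and>
    (\<forall>g h. commutative_square \<A> g h c d \<longrightarrow>
      (\<exists>!k. k \<in> homset \<A> (Dom \<A> g) (Dom \<A> a) \<and> a \<cdot>\<^bsub>\<A>\<^esub> k = g \<and> b \<cdot>\<^bsub>\<A>\<^esub> k = h))"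

definition bicartesian :: "('o, 'm, 'z) cat_scheme \<Rightarrow> 'm \<Rightarrow> 'm \<Rightarrow> 'm \<Rightarrow> 'm \<Rightarrow> bool" where
  "bicartesian \<A> a b c d \<longleftrightarrow> is_pushout \<A> a b c d \<and> is_pullback \<A> a b c d"

text \<open>\<open>Zero \<A> A B\<close> is the zero morphism from \<open>A\<close> to \<open>B\<close>.\<close>

record ('o, 'm) acat = "('o, 'm) cat" +
  Add :: "'m \<Rightarrow> 'm \<Rightarrow> 'm"
  Zero :: "'o \<Rightarrow> 'o \<Rightarrow> 'm"

definition hom_group :: "('o, 'm, 'z) acat_scheme \<Rightarrow> 'o \<Rightarrow> 'o \<Rightarrow> 'm monoid" where
  "hom_group \<A> A B = \<lparr>carrier = homset \<A> A B, mult = Add \<A>, one = Zero \<A> A B\<rparr>"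

definition zero_object :: "('o, 'm, 'z) cat_scheme \<Rightarrow> 'o \<Rightarrow> bool" where
  "zero_object \<A> N \<longleftrightarrow> N \<in> Obj \<A> \<and>
    (\<forall>A \<in> Obj \<A>. (\<exists>!f. f \<in> homset \<A> N A) \<and> (\<exists>!f. f \<in> homset \<A> A N))"

definition is_biproduct ::
  "('o, 'm, 'z) acat_scheme \<Rightarrow> 'o \<Rightarrow> 'o \<Rightarrow> 'o \<Rightarrow> 'm \<Rightarrow> 'm \<Rightarrow> 'm \<Rightarrow> 'm \<Rightarrow> bool" where
  "is_biproduct \<A> A B S i j p q \<longleftrightarrow>
    i \<in> homset \<A> A S \<and> j \<in> homset \<A> B S \<and> p \<in> homset \<A> S A \<and> q \<in> homset \<A> S B \<and>
    p \<cdot>\<^bsub>\<A>\<^esub> i = Ident \<A> A \<and> q \<cdot>\<^bsub>\<A>\<^esub> j = Ident \<A> B \<and>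
    p \<cdot>\<^bsub>\<A>\<^esub> j = Zero \<A> B A \<and> q \<cdot>\<^bsub>\<A>\<^esub> i = Zero \<A> A B \<and>
    Add \<A> (i \<cdot>\<^bsub>\<A>\<^esub> p) (j \<cdot>\<^bsub>\<A>\<^esub> q) = Ident \<A> S"

locale additive_category = category \<A>
  for \<A> :: "('o, 'm, 'z) acat_scheme" (structure) +
  assumes hom_comm_group: "A \<in> Obj \<A> \<Longrightarrow> B \<in> Obj \<A> \<Longrightarrow> comm_group (hom_group \<A> A B)"
    and Comp_Add_left: "f \<in> homset \<A> A B \<Longrightarrow> g \<in> homset \<A> B C \<Longrightarrow> h \<in> homset \<A> B C
      \<Longrightarrow> Add \<A> g h \<cdot> f = Add \<A> (g \<cdot> f) (h \<cdot> f)"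
    and Comp_Add_right: "f \<in> homset \<A> A B \<Longrightarrow> g \<in> homset \<A> A B \<Longrightarrow> h \<in> homset \<A> B C
      \<Longrightarrow> h \<cdot> Add \<A> f g = Add \<A> (h \<cdot> f) (h \<cdot> g)"
    and ex_zero_object: "\<exists>N. zero_object \<A> N"
    and ex_biproduct: "A \<in> Obj \<A> \<Longrightarrow> B \<in> Obj \<A> \<Longrightarrow> \<exists>S i j p q. is_biproduct \<A> A B S i j p q"

definition is_kernel :: "('o, 'm, 'z) acat_scheme \<Rightarrow> 'm \<Rightarrow> 'm \<Rightarrow> bool" where
  "is_kernel \<A> i p \<longleftrightarrow> i \<in> Arr \<A> \<and> p \<in> Arr \<A> \<and> Cod \<A> i = Dom \<A> p \<and>
    p \<cdot>\<^bsub>\<A>\<^esub> i = Zero \<A> (Dom \<A> i) (Cod \<A> p) \<and>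
    (\<forall>f \<in> Arr \<A>. Cod \<A> f = Dom \<A> p \<and> p \<cdot>\<^bsub>\<A>\<^esub> f = Zero \<A> (Dom \<A> f) (Cod \<A> p) \<longrightarrow>
      (\<exists>!k. k \<in> homset \<A> (Dom \<A> f) (Dom \<A> i) \<and> i \<cdot>\<^bsub>\<A>\<^esub> k = f))"

definition is_cokernel :: "('o, 'm, 'z) acat_scheme \<Rightarrow> 'm \<Rightarrow> 'm \<Rightarrow> bool" where
  "is_cokernel \<A> p i \<longleftrightarrow> p \<in> Arr \<A> \<and> i \<in> Arr \<A> \<and> Cod \<A> i = Dom \<A> p \<and>
    p \<cdot>\<^bsub>\<A>\<^esub> i = Zero \<A> (Dom \<A> i) (Cod \<A> p) \<and>
    (\<forall>f \<in> Arr \<A>. Dom \<A> f = Cod \<A> i \<and> f \<cdot>\<^bsub>\<A>\<^esub> i = Zero \<A> (Dom \<A> i) (Cod \<A> f) \<longrightarrow>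
      (\<exists>!k. k \<in> homset \<A> (Cod \<A> p) (Cod \<A> f) \<and> k \<cdot>\<^bsub>\<A>\<^esub> p = f))"

definition kernel_cokernel_pair :: "('o, 'm, 'z) acat_scheme \<Rightarrow> 'm \<Rightarrow> 'm \<Rightarrow> bool" where
  "kernel_cokernel_pair \<A> i p \<longleftrightarrow> is_kernel \<A> i p \<and> is_cokernel \<A> p i"

definition admissible_monic :: "('m \<times> 'm) set \<Rightarrow> 'm \<Rightarrow> bool" where
  "admissible_monic \<E> i \<longleftrightarrow> (\<exists>p. (i, p) \<in> \<E>)"

definition admissible_epic :: "('m \<times> 'm) set \<Rightarrow> 'm \<Rightarrow> bool" where
  "admissible_epic \<E> p \<longleftrightarrow> (\<exists>i. (i, p) \<in> \<E>)"

definition pair_isomorphism ::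
  "('o, 'm, 'z) cat_scheme \<Rightarrow> 'm \<times> 'm \<Rightarrow> 'm \<times> 'm \<Rightarrow> 'm \<Rightarrow> 'm \<Rightarrow> 'm \<Rightarrow> bool" where
  "pair_isomorphism \<A> = (\<lambda>(i, p) (i', p') a b c.
    isomorphism \<A> a \<and> isomorphism \<A> b \<and> isomorphism \<A> c \<and>
    commutative_square \<A> i a b i' \<and> commutative_square \<A> p b c p')"

text \<open>
  In \<open>is_pushout \<A> i f f' i'\<close> the side opposite to \<open>i\<close> is \<open>i'\<close>, and in \<open>is_pullback \<A> f' p' p f\<close> the
  side opposite to \<open>p\<close> is \<open>p'\<close>. As \<open>\<E>\<close> is closed under isomorphisms, asking for an admissible \<open>i'\<close>
  in one push-out of \<open>i\<close> along \<open>f\<close>, or in all of them, amounts to the same; likewise for \<open>p'\<close>.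
\<close>

locale exact_category = additive_category \<A>
  for \<A> :: "('o, 'm, 'z) acat_scheme" (structure) +
  fixes \<E> :: "('m \<times> 'm) set"
  assumes kernel_cokernel: "(i, p) \<in> \<E> \<Longrightarrow> kernel_cokernel_pair \<A> i p"
    and iso_closed: "(i, p) \<in> \<E> \<Longrightarrow> pair_isomorphism \<A> (i, p) (i', p') a b c \<Longrightarrow> (i', p') \<in> \<E>"
    and Ident_monic: "A \<in> Obj \<A> \<Longrightarrow> admissible_monic \<E> (Ident \<A> A)"
    and Ident_epic: "A \<in> Obj \<A> \<Longrightarrow> admissible_epic \<E> (Ident \<A> A)"
    and Comp_monic: "admissible_monic \<E> i \<Longrightarrow> admissible_monic \<E> j \<Longrightarrow> Cod \<A> i = Dom \<A> j
      \<Longrightarrow> admissible_monic \<E> (j \<cdot> i)"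
    and Comp_epic: "admissible_epic \<E> p \<Longrightarrow> admissible_epic \<E> q \<Longrightarrow> Cod \<A> p = Dom \<A> q
      \<Longrightarrow> admissible_epic \<E> (q \<cdot> p)"
    and ex_pushout: "admissible_monic \<E> i \<Longrightarrow> f \<in> Arr \<A> \<Longrightarrow> Dom \<A> i = Dom \<A> f
      \<Longrightarrow> \<exists>f' i'. is_pushout \<A> i f f' i'"
    and pushout_monic: "admissible_monic \<E> i \<Longrightarrow> is_pushout \<A> i f f' i' \<Longrightarrow> admissible_monic \<E> i'"
    and ex_pullback: "admissible_epic \<E> p \<Longrightarrow> f \<in> Arr \<A> \<Longrightarrow> Cod \<A> p = Cod \<A> f
      \<Longrightarrow> \<exists>f' p'. is_pullback \<A> f' p' p f"
    and pullback_epic: "admissible_epic \<E> p \<Longrightarrow> is_pullback \<A> f' p' p f \<Longrightarrow> admissible_epic \<E> p'"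

definition short_exact ::
  "('o, 'm, 'z) cat_scheme \<Rightarrow> ('m \<times> 'm) set \<Rightarrow> 'o \<Rightarrow> 'm \<Rightarrow> 'o \<Rightarrow> 'm \<Rightarrow> 'o \<Rightarrow> bool" where
  "short_exact \<A> \<E> A i B p C \<longleftrightarrow>
    i \<in> homset \<A> A B \<and> p \<in> homset \<A> B C \<and> (i, p) \<in> \<E>"

end

theory Submission
  imports Defs
begin

text \<open>
  The maps \<open>x\<close> and \<open>y\<close> come from the universal properties of the cokernels \<open>q\<close> and \<open>r\<close>. Since
  \<open>q\<close> is a cokernel of \<open>u\<close> and \<open>r\<close> is a cokernel of \<open>v \<cdot> u\<close>, the square is a push-out, so \<open>x\<close> is an
  admissible monic; \<open>y\<close> is a cokernel of it, and since cokernels are unique up to isomorphism,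
  \<open>(x, y) \<in> \<E>\<close>. That the square is a pull-back follows because \<open>v\<close> is the kernel of \<open>t = y \<cdot> r\<close>
  and \<open>x\<close> is monic.
\<close>

section \<open>Hom-sets, squares and identities\<close>

lemma homsetD:
  assumes "f \<in> homset \<A> A B"
  shows "f \<in> Arr \<A>" "Dom \<A> f = A" "Cod \<A> f = B"
  using assms by (auto simp: homset_def)

lemma commutative_square_swap:
  "commutative_square \<A> a b c d \<longleftrightarrow> commutative_square \<A> b a d c"
  by (auto simp: commutative_square_def)

text \<open>The push-out axiom makes admissible the side opposite to the first argument, whereas the
  square of the theorem is listed with \<open>q\<close> first. The symmetry allows \<open>v\<close>
  to take that place.\<close>

lemma is_pushout_swap:
  assumes "is_pushout \<A> a b c d"
  shows "is_pushout \<A> b a d c"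
  unfolding is_pushout_def
proof (intro conjI allI impI)
  show "commutative_square \<A> b a d c"
    using assms commutative_square_swap[of \<A> a b c d] by (auto simp: is_pushout_def)
next
  fix g h assume "commutative_square \<A> b a g h"
  then have hg: "commutative_square \<A> a b h g"
    using commutative_square_swap[of \<A> b a g h] by blast
  \<comment> \<open>The universal property names its hom-set through the third side of each square.
    Commutativity identifies these codomains with those of the fourth sides.\<close>
  have eqs: "Cod \<A> d = Cod \<A> c" "Cod \<A> g = Cod \<A> h"
    using assms hg by (auto simp: is_pushout_def commutative_square_def)
  have "\<exists>!k. k \<in> homset \<A> (Cod \<A> c) (Cod \<A> h) \<and> k \<cdot>\<^bsub>\<A>\<^esub> c = h \<and> k \<cdot>\<^bsub>\<A>\<^esub> d = g"
    using assms hg by (auto simp: is_pushout_def)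
  then show "\<exists>!k. k \<in> homset \<A> (Cod \<A> d) (Cod \<A> g) \<and> k \<cdot>\<^bsub>\<A>\<^esub> d = g \<and> k \<cdot>\<^bsub>\<A>\<^esub> c = h"
    unfolding eqs by (simp add: conj_commute)
qed

context category
begin

lemma homset_Obj:
  assumes "f \<in> homset \<A> A B"
  shows "A \<in> Obj \<A>" "B \<in> Obj \<A>"
  using assms Dom_Obj Cod_Obj by (auto simp: homset_def)

lemma isomorphism_Ident:
  assumes "A \<in> Obj \<A>"
  shows "isomorphism \<A> (Ident \<A> A)"
  using Ident_hom[OF assms] Comp_Ident[OF Ident_hom[OF assms]]
  by (auto simp: isomorphism_def homset_def)

end

section \<open>Zero morphisms in an additive category\<close>

context additive_category
begin

lemma Zero_hom:
  assumes "A \<in> Obj \<A>" "B \<in> Obj \<A>"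
  shows "Zero \<A> A B \<in> homset \<A> A B"
proof -
  interpret comm_group "hom_group \<A> A B" by (rule hom_comm_group[OF assms])
  show ?thesis using one_closed by (simp add: hom_group_def)
qed

text \<open>Cancellation in the group of morphisms. This is how a composite with a zero morphism is
  recognised as zero.\<close>

lemma idempotent_eq_Zero:
  assumes f: "f \<in> homset \<A> A B" and "Add \<A> f f = f"
  shows "f = Zero \<A> A B"
proof -
  interpret comm_group "hom_group \<A> A B"
    by (rule hom_comm_group[OF homset_Obj[OF f]])
  show ?thesis using l_cancel_one[of f f] assms by (simp add: hom_group_def)
qed

lemma Add_Zero_Zero:
  assumes "A \<in> Obj \<A>" "B \<in> Obj \<A>"
  shows "Add \<A> (Zero \<A> A B) (Zero \<A> A B) = Zero \<A> A B"
proof -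
  interpret comm_group "hom_group \<A> A B" by (rule hom_comm_group[OF assms])
  show ?thesis using l_one[OF one_closed] by (simp add: hom_group_def)
qed

text \<open>Composition with \<open>f\<close> is additive, so it sends 0 = 0 + 0 to an element that
  equals its own double.\<close>

lemma Comp_Zero:
  assumes A: "A \<in> Obj \<A>" and f: "f \<in> homset \<A> B C"
  shows "f \<cdot> Zero \<A> A B = Zero \<A> A C"
proof -
  have B: "B \<in> Obj \<A>" by (rule homset_Obj[OF f])
  have z: "Zero \<A> A B \<in> homset \<A> A B" by (rule Zero_hom[OF A B])
  show ?thesis
    using Comp_Add_right[OF z z f] Add_Zero_Zero[OF A B] Comp_hom[OF z f]
    by (intro idempotent_eq_Zero) auto
qed

lemma Zero_Comp:
  assumes C: "C \<in> Obj \<A>" and f: "f \<in> homset \<A> A B"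
  shows "Zero \<A> B C \<cdot> f = Zero \<A> A C"
proof -
  have B: "B \<in> Obj \<A>" by (rule homset_Obj[OF f])
  have z: "Zero \<A> B C \<in> homset \<A> B C" by (rule Zero_hom[OF B C])
  show ?thesis
    using Comp_Add_left[OF f z z] Add_Zero_Zero[OF B C] Comp_hom[OF f z]
    by (intro idempotent_eq_Zero) auto
qed

section \<open>Kernels: lifting and cancellation\<close>

lemma kernel_ex1:
  assumes ker: "is_kernel \<A> i p" and i: "i \<in> homset \<A> A B" and p: "p \<in> homset \<A> B C"
    and f: "f \<in> homset \<A> T B" and pf: "p \<cdot> f = Zero \<A> T C"
  shows "\<exists>!k. k \<in> homset \<A> T A \<and> i \<cdot> k = f"
proof -
  have "\<forall>f \<in> Arr \<A>. Cod \<A> f = Dom \<A> p \<and> p \<cdot> f = Zero \<A> (Dom \<A> f) (Cod \<A> p) \<longrightarrow>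
      (\<exists>!k. k \<in> homset \<A> (Dom \<A> f) (Dom \<A> i) \<and> i \<cdot> k = f)"
    using ker unfolding is_kernel_def by (elim conjE)
  from bspec[OF this homsetD(1)[OF f]] show ?thesis
    unfolding homsetD(2,3)[OF i] homsetD(2,3)[OF p] homsetD(2,3)[OF f] using pf
    by (elim impE) (rule conjI[OF refl])
qed

lemma kernel_lift:
  assumes "is_kernel \<A> i p" "i \<in> homset \<A> A B" "p \<in> homset \<A> B C"
    and "f \<in> homset \<A> T B" "p \<cdot> f = Zero \<A> T C"
  obtains k where "k \<in> homset \<A> T A" "i \<cdot> k = f"
  using kernel_ex1[OF assms] by (elim ex1E conjE)

lemma kernel_Zero:
  assumes "is_kernel \<A> i p" "i \<in> homset \<A> A B" "p \<in> homset \<A> B C"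
  shows "p \<cdot> i = Zero \<A> A C"
  using assms by (auto simp: is_kernel_def homset_def)

text \<open>Both \<open>k\<close> and \<open>l\<close> factor the same morphism
  \<open>i \<cdot> k\<close>, which \<open>p\<close> kills, so the uniqueness in the universal
  property identifies them.\<close>

lemma kernel_monic:
  assumes ker: "is_kernel \<A> i p" and i: "i \<in> homset \<A> A B"
    and k: "k \<in> homset \<A> T A" and l: "l \<in> homset \<A> T A" and eq: "i \<cdot> k = i \<cdot> l"
  shows "k = l"
proof -
  have p: "p \<in> homset \<A> B (Cod \<A> p)"
    using ker i by (auto simp: is_kernel_def homset_def)
  have f: "i \<cdot> k \<in> homset \<A> T B" by (rule Comp_hom[OF k i])
  have "p \<cdot> (i \<cdot> k) = Zero \<A> T (Cod \<A> p)"
    using Comp_assoc[OF k i p] kernel_Zero[OF ker i p] Zero_Comp[OF homset_Obj(2)[OF p] k]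
    by simp
  then have "\<exists>!m. m \<in> homset \<A> T A \<and> i \<cdot> m = i \<cdot> k"
    by (rule kernel_ex1[OF ker i p f])
  then show ?thesis using k l eq by metis
qed

section \<open>Cokernels: descent, cancellation and uniqueness up to isomorphism\<close>

lemma cokernel_ex1:
  assumes coker: "is_cokernel \<A> p i" and i: "i \<in> homset \<A> A B" and p: "p \<in> homset \<A> B C"
    and f: "f \<in> homset \<A> B T" and fi: "f \<cdot> i = Zero \<A> A T"
  shows "\<exists>!k. k \<in> homset \<A> C T \<and> k \<cdot> p = f"
proof -
  have "\<forall>f \<in> Arr \<A>. Dom \<A> f = Cod \<A> i \<and> f \<cdot> i = Zero \<A> (Dom \<A> i) (Cod \<A> f) \<longrightarrow>
      (\<exists>!k. k \<in> homset \<A> (Cod \<A> p) (Cod \<A> f) \<and> k \<cdot> p = f)"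
    using coker unfolding is_cokernel_def by (elim conjE)
  from bspec[OF this homsetD(1)[OF f]] show ?thesis
    unfolding homsetD(2,3)[OF i] homsetD(2,3)[OF p] homsetD(2,3)[OF f] using fi
    by (elim impE) (rule conjI[OF refl])
qed

lemma cokernel_desc:
  assumes "is_cokernel \<A> p i" "i \<in> homset \<A> A B" "p \<in> homset \<A> B C"
    and "f \<in> homset \<A> B T" "f \<cdot> i = Zero \<A> A T"
  obtains k where "k \<in> homset \<A> C T" "k \<cdot> p = f"
  using cokernel_ex1[OF assms] by (elim ex1E conjE)

lemma cokernel_Zero:
  assumes "is_cokernel \<A> p i" "i \<in> homset \<A> A B" "p \<in> homset \<A> B C"
  shows "p \<cdot> i = Zero \<A> A C"
  using assms by (auto simp: is_cokernel_def homset_def)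

lemma cokernel_epic:
  assumes coker: "is_cokernel \<A> p i" and p: "p \<in> homset \<A> B C"
    and k: "k \<in> homset \<A> C T" and l: "l \<in> homset \<A> C T" and eq: "k \<cdot> p = l \<cdot> p"
  shows "k = l"
proof -
  have i: "i \<in> homset \<A> (Dom \<A> i) B"
    using coker p by (auto simp: is_cokernel_def homset_def)
  have f: "k \<cdot> p \<in> homset \<A> B T" by (rule Comp_hom[OF p k])
  have "k \<cdot> p \<cdot> i = Zero \<A> (Dom \<A> i) T"
    using Comp_assoc[OF i p k] cokernel_Zero[OF coker i p] Comp_Zero[OF homset_Obj(1)[OF i] k]
    by simp
  then have "\<exists>!m. m \<in> homset \<A> C T \<and> m \<cdot> p = k \<cdot> p"
    by (rule cokernel_ex1[OF coker i p f])
  then show ?thesis using k l eq by metis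
qed

text \<open>Unique existence is split into existence of a factorization and right cancellation of
  \<open>p\<close>, which are proved by separate diagram chases later.\<close>

lemma cokernelI:
  assumes i: "i \<in> homset \<A> A B" and p: "p \<in> homset \<A> B C"
    and zero: "p \<cdot> i = Zero \<A> A C"
    and desc: "\<And>T f. f \<in> homset \<A> B T \<Longrightarrow> f \<cdot> i = Zero \<A> A T \<Longrightarrow>
      \<exists>k \<in> homset \<A> C T. k \<cdot> p = f"
    and epic: "\<And>T k l. k \<in> homset \<A> C T \<Longrightarrow> l \<in> homset \<A> C T \<Longrightarrow> k \<cdot> p = l \<cdot> p \<Longrightarrow> k = l"
  shows "is_cokernel \<A> p i"
  unfolding is_cokernel_def homsetD[OF i] homsetD[OF p]
proof (intro conjI ballI impI TrueI refl)
  show "p \<in> Arr \<A>" "i \<in> Arr \<A>" using homsetD(1)[OF p] homsetD(1)[OF i] by auto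
  show "p \<cdot> i = Zero \<A> A C" by (rule zero)
next
  fix f assume "f \<in> Arr \<A>" and "Dom \<A> f = B \<and> f \<cdot> i = Zero \<A> A (Cod \<A> f)"
  then obtain k where "k \<in> homset \<A> C (Cod \<A> f)" "k \<cdot> p = f"
    using desc[of f "Cod \<A> f"] by (auto simp: homset_def)
  then show "\<exists>!k. k \<in> homset \<A> C (Cod \<A> f) \<and> k \<cdot> p = f"
    using epic by (intro ex1I[of _ k]) auto
qed

text \<open>Each cokernel factors through the other. Both composites of the two factorizations are
  identities, because cokernels can be cancelled on the right.\<close>

lemma cokernel_unique:
  assumes p: "is_cokernel \<A> p i" and p': "is_cokernel \<A> p' i"
    and i: "i \<in> homset \<A> A B" and ph: "p \<in> homset \<A> B C" and ph': "p' \<in> homset \<A> B C'"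
  obtains c where "c \<in> homset \<A> C C'" "c \<cdot> p = p'" "isomorphism \<A> c"
proof -
  obtain c where c: "c \<in> homset \<A> C C'" "c \<cdot> p = p'"
    using cokernel_desc[OF p i ph ph' cokernel_Zero[OF p' i ph']] .
  obtain d where d: "d \<in> homset \<A> C' C" "d \<cdot> p' = p"
    using cokernel_desc[OF p' i ph' ph cokernel_Zero[OF p i ph]] .
  have CC': "C \<in> Obj \<A>" "C' \<in> Obj \<A>" using homset_Obj[OF c(1)] by auto
  have "d \<cdot> c = Ident \<A> C"
    using Comp_assoc[OF ph c(1) d(1)] c d Ident_Comp[OF ph]
    by (intro cokernel_epic[OF p ph Comp_hom[OF c(1) d(1)] Ident_hom[OF CC'(1)]]) simp
  moreover have "c \<cdot> d = Ident \<A> C'"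
    using Comp_assoc[OF ph' d(1) c(1)] c d Ident_Comp[OF ph']
    by (intro cokernel_epic[OF p' ph' Comp_hom[OF d(1) c(1)] Ident_hom[OF CC'(2)]]) simp
  ultimately have "isomorphism \<A> c"
    using c(1) d(1) by (auto simp: isomorphism_def homset_def)
  then show thesis using that c by blast
qed

end

section \<open>Short exact sequences and the square of the theorem\<close>

context exact_category
begin

lemma short_exactD:
  assumes "short_exact \<A> \<E> A i B p C"
  shows "i \<in> homset \<A> A B" "p \<in> homset \<A> B C" "(i, p) \<in> \<E>" "is_kernel \<A> i p" "is_cokernel \<A> p i"
  using assms kernel_cokernel by (auto simp: short_exact_def kernel_cokernel_pair_def)

text \<open>Admissibility pairs \<open>i\<close> with some cokernel \<open>p'\<close> in
  \<open>\<E>\<close>. Any other cokernel differs from \<open>p'\<close> by an isomorphism, and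
  \<open>\<E>\<close> is closed under isomorphisms of pairs.\<close>

lemma cokernel_of_admissible_monic:
  assumes "admissible_monic \<E> i" and coker: "is_cokernel \<A> p i"
    and i: "i \<in> homset \<A> A B" and p: "p \<in> homset \<A> B C"
  shows "short_exact \<A> \<E> A i B p C"
proof -
  obtain p' where p'E: "(i, p') \<in> \<E>" using assms by (auto simp: admissible_monic_def)
  then have coker': "is_cokernel \<A> p' i"
    using kernel_cokernel by (auto simp: kernel_cokernel_pair_def)
  have p': "p' \<in> homset \<A> B (Cod \<A> p')"
    using coker' i by (auto simp: is_cokernel_def homset_def)
  obtain c where c: "c \<in> homset \<A> (Cod \<A> p') C" "c \<cdot> p' = p" "isomorphism \<A> c"
    using cokernel_unique[OF coker' coker i p' p] .
  have AB: "A \<in> Obj \<A>" "B \<in> Obj \<A>" using homset_Obj[OF i] by auto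
  \<comment> \<open>The isomorphism of pairs is the identity on \<open>A\<close> and
    \<open>B\<close>, and the comparison \<open>c\<close> on the cokernel objects.\<close>
  have "commutative_square \<A> i (Ident \<A> A) (Ident \<A> B) i"
    using homsetD[OF i] homsetD[OF Ident_hom[OF AB(1)]] homsetD[OF Ident_hom[OF AB(2)]]
      Comp_Ident[OF i] Ident_Comp[OF i]
    by (simp add: commutative_square_def)
  moreover have "commutative_square \<A> p' (Ident \<A> B) c p"
    using homsetD[OF p'] homsetD[OF p] homsetD[OF c(1)] homsetD[OF Ident_hom[OF AB(2)]]
      Comp_Ident[OF p] c(2)
    by (simp add: commutative_square_def)
  ultimately have "pair_isomorphism \<A> (i, p') (i, p) (Ident \<A> A) (Ident \<A> B) c"
    using c(3) isomorphism_Ident AB by (simp add: pair_isomorphism_def)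
  then have "(i, p) \<in> \<E>" by (rule iso_closed[OF p'E])
  then show ?thesis using i p by (simp add: short_exact_def)
qed

text \<open>If \<open>g \<cdot> q = h \<cdot> v\<close>, then \<open>h\<close> kills
  \<open>v \<cdot> u\<close> because \<open>q\<close> kills \<open>u\<close>, so \<open>h\<close>
  descends along the cokernel \<open>r\<close>. Cancelling \<open>q\<close> shows that the descended
  map restricts to \<open>g\<close> along \<open>x\<close>, and cancelling \<open>r\<close> gives
  uniqueness.\<close>

lemma noether_pushout:
  assumes uq: "short_exact \<A> \<E> A u B q X" and wr: "short_exact \<A> \<E> A (v \<cdot> u) C r Y"
    and v: "v \<in> homset \<A> B C" and x: "x \<in> homset \<A> X Y" and xq: "x \<cdot> q = r \<cdot> v"
  shows "is_pushout \<A> q v x r"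
  unfolding is_pushout_def
proof (intro conjI allI impI)
  note u = short_exactD[OF uq] and w = short_exactD[OF wr]
  show "commutative_square \<A> q v x r"
    using homsetD[OF u(2)] homsetD[OF v] homsetD[OF x] homsetD[OF w(2)] xq
    by (simp add: commutative_square_def)
  fix g h assume sq: "commutative_square \<A> q v g h"
  define T where "T = Cod \<A> g"
  have g: "g \<in> homset \<A> X T" and h: "h \<in> homset \<A> C T" and gq: "g \<cdot> q = h \<cdot> v"
    using sq homsetD[OF u(2)] homsetD[OF v] by (auto simp: T_def commutative_square_def homset_def)
  have "h \<cdot> (v \<cdot> u) = g \<cdot> (q \<cdot> u)"
    using Comp_assoc[OF u(1) v h] Comp_assoc[OF u(1) u(2) g] gq by simp
  also have "\<dots> = Zero \<A> A T"
    using cokernel_Zero[OF u(5,1,2)] Comp_Zero[OF homset_Obj(1)[OF u(1)] g] by simp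
  finally obtain k where k: "k \<in> homset \<A> Y T" "k \<cdot> r = h"
    using cokernel_desc[OF w(5,1,2) h] by blast
  have "k \<cdot> x \<cdot> q = g \<cdot> q"
    using Comp_assoc[OF u(2) x k(1)] Comp_assoc[OF v w(2) k(1)] xq k(2) gq by simp
  then have "k \<cdot> x = g" by (rule cokernel_epic[OF u(5,2) Comp_hom[OF x k(1)] g])
  then show "\<exists>!k. k \<in> homset \<A> (Cod \<A> x) (Cod \<A> g) \<and> k \<cdot> x = g \<and> k \<cdot> r = h"
    unfolding homsetD(3)[OF x] T_def[symmetric]
    using k cokernel_epic[OF w(5,2)] by (intro ex1I[of _ k]) auto
qed

text \<open>If \<open>x \<cdot> g = r \<cdot> h\<close>, then
  \<open>t \<cdot> h = y \<cdot> x \<cdot> g\<close> vanishes, so \<open>h\<close> lifts through the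
  kernel \<open>v\<close> of \<open>t\<close>. Cancelling the monic \<open>x\<close> shows that the
  lift also induces \<open>g\<close>, and cancelling \<open>v\<close> gives uniqueness.\<close>

lemma noether_pullback:
  assumes vt: "short_exact \<A> \<E> B v C t Z" and xy: "short_exact \<A> \<E> X x Y y Z"
    and q: "q \<in> homset \<A> B X" and r: "r \<in> homset \<A> C Y"
    and xq: "x \<cdot> q = r \<cdot> v" and yr: "y \<cdot> r = t"
  shows "is_pullback \<A> q v x r"
  unfolding is_pullback_def
proof (intro conjI allI impI)
  note v = short_exactD[OF vt] and x = short_exactD[OF xy]
  show "commutative_square \<A> q v x r"
    using homsetD[OF q] homsetD[OF v(1)] homsetD[OF x(1)] homsetD[OF r] xq
    by (simp add: commutative_square_def)
  fix g h assume sq: "commutative_square \<A> g h x r"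
  define T where "T = Dom \<A> g"
  have g: "g \<in> homset \<A> T X" and h: "h \<in> homset \<A> T C" and xg: "x \<cdot> g = r \<cdot> h"
    using sq homsetD[OF x(1)] homsetD[OF r] by (auto simp: T_def commutative_square_def homset_def)
  have "t \<cdot> h = y \<cdot> x \<cdot> g"
    using Comp_assoc[OF h r x(2)] Comp_assoc[OF g x(1) x(2)] xg yr by simp
  also have "\<dots> = Zero \<A> T Z"
    using kernel_Zero[OF x(4,1,2)] Zero_Comp[OF homset_Obj(2)[OF x(2)] g] by simp
  finally obtain k where k: "k \<in> homset \<A> T B" "v \<cdot> k = h"
    using kernel_lift[OF v(4,1,2) h] by blast
  have "x \<cdot> (q \<cdot> k) = x \<cdot> g"
    using Comp_assoc[OF k(1) q x(1)] Comp_assoc[OF k(1) v(1) r] xq k(2) xg by simp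
  then have "q \<cdot> k = g" by (rule kernel_monic[OF x(4,1) Comp_hom[OF k(1) q] g])
  then show "\<exists>!k. k \<in> homset \<A> (Dom \<A> g) (Dom \<A> q) \<and> q \<cdot> k = g \<and> v \<cdot> k = h"
    unfolding homsetD(2)[OF q] T_def[symmetric]
    using k kernel_monic[OF v(4,1)] by (intro ex1I[of _ k]) auto
qed

text \<open>Equations out of \<open>X\<close> and \<open>Y\<close> are tested after composing with
  the epics \<open>q\<close> and \<open>r\<close>, which moves them to \<open>B\<close> and
  \<open>C\<close>. There the cokernel property of \<open>t\<close> applies.\<close>

lemma noether_cokernel:
  assumes vt: "short_exact \<A> \<E> B v C t Z" and uq: "short_exact \<A> \<E> A u B q X"
    and wr: "short_exact \<A> \<E> A w C r Y"
    and x: "x \<in> homset \<A> X Y" and y: "y \<in> homset \<A> Y Z"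
    and xq: "x \<cdot> q = r \<cdot> v" and yr: "y \<cdot> r = t"
  shows "is_cokernel \<A> y x"
proof (rule cokernelI[OF x y])
  note v = short_exactD[OF vt] and u = short_exactD[OF uq] and w = short_exactD[OF wr]
  have X: "X \<in> Obj \<A>" and Z: "Z \<in> Obj \<A>" using homset_Obj[OF x] homset_Obj[OF y] by auto
  have "y \<cdot> x \<cdot> q = t \<cdot> v"
    using Comp_assoc[OF u(2) x y] Comp_assoc[OF v(1) w(2) y] xq yr by simp
  \<comment> \<open>The zero morphism is rewritten as a composite with \<open>q\<close> so that
    \<open>q\<close> can be cancelled.\<close>
  also have "\<dots> = Zero \<A> X Z \<cdot> q"
    using cokernel_Zero[OF v(5,1,2)] Zero_Comp[OF Z u(2)] by simp
  finally show "y \<cdot> x = Zero \<A> X Z"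
    by (rule cokernel_epic[OF u(5,2) Comp_hom[OF x y] Zero_hom[OF X Z]])
next
  note v = short_exactD[OF vt] and u = short_exactD[OF uq] and w = short_exactD[OF wr]
  fix T f assume f: "f \<in> homset \<A> Y T" and fx: "f \<cdot> x = Zero \<A> X T"
  \<comment> \<open>A morphism \<open>f\<close> killing \<open>x\<close> gives
    \<open>f \<cdot> r\<close> killing \<open>v\<close>. Hence \<open>f \<cdot> r\<close> factors
    through \<open>t = y \<cdot> r\<close>, and cancelling \<open>r\<close> factors \<open>f\<close>
    through \<open>y\<close>.\<close>
  have "f \<cdot> r \<cdot> v = f \<cdot> x \<cdot> q"
    using Comp_assoc[OF u(2) x f] Comp_assoc[OF v(1) w(2) f] xq by simp
  also have "\<dots> = Zero \<A> B T" using Zero_Comp[OF homset_Obj(2)[OF f] u(2)] fx by simp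
  finally obtain k where k: "k \<in> homset \<A> Z T" "k \<cdot> t = f \<cdot> r"
    using cokernel_desc[OF v(5,1,2) Comp_hom[OF w(2) f]] by blast
  have "k \<cdot> y \<cdot> r = f \<cdot> r" using Comp_assoc[OF w(2) y k(1)] yr k(2) by simp
  then have "k \<cdot> y = f" by (rule cokernel_epic[OF w(5,2) Comp_hom[OF y k(1)] f])
  then show "\<exists>k \<in> homset \<A> Z T. k \<cdot> y = f" using k(1) by blast
next
  note v = short_exactD[OF vt] and w = short_exactD[OF wr]
  fix T k l assume k: "k \<in> homset \<A> Z T" and l: "l \<in> homset \<A> Z T" and "k \<cdot> y = l \<cdot> y"
  then have "k \<cdot> t = l \<cdot> t"
    using Comp_assoc[OF w(2) y k] Comp_assoc[OF w(2) y l] yr by simp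
  then show "k = l" by (rule cokernel_epic[OF v(5,2) k l])
qed

end

theorem lemma3p5:
  fixes \<A> :: "('o, 'm, 'z) acat_scheme" and \<E> :: "('m \<times> 'm) set"
    and A B C X Y Z :: 'o and u v w q r t :: 'm
  assumes "exact_category \<A> \<E>"
    and "short_exact \<A> \<E> A u B q X"
    and "short_exact \<A> \<E> A w C r Y"
    and "short_exact \<A> \<E> B v C t Z"
    and "w = v \<cdot>\<^bsub>\<A>\<^esub> u"
  shows "let diagram = (\<lambda>x y. x \<in> homset \<A> X Y \<and> y \<in> homset \<A> Y Z \<and>
           v \<cdot>\<^bsub>\<A>\<^esub> u = w \<cdot>\<^bsub>\<A>\<^esub> Ident \<A> A \<and>
           x \<cdot>\<^bsub>\<A>\<^esub> q = r \<cdot>\<^bsub>\<A>\<^esub> v \<and>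
           y \<cdot>\<^bsub>\<A>\<^esub> r = Ident \<A> Z \<cdot>\<^bsub>\<A>\<^esub> t)
         in \<exists>x y. diagram x y \<and>
              (\<forall>x' y'. diagram x' y' \<longrightarrow> x' = x \<and> y' = y) \<and>
              short_exact \<A> \<E> X x Y y Z \<and>
              bicartesian \<A> q v x r"
proof -
  interpret exact_category \<A> \<E> by fact
  note u = short_exactD[OF assms(2)] and w = short_exactD[OF assms(3)]
    and v = short_exactD[OF assms(4)]
  have A: "A \<in> Obj \<A>" by (rule homset_Obj[OF u(1)])
  \<comment> \<open>Since \<open>r\<close> kills \<open>w = v \<cdot> u\<close>, the composite
    \<open>r \<cdot> v\<close> descends along \<open>q\<close>, which yields
    \<open>x\<close>.\<close>
  have "r \<cdot>\<^bsub>\<A>\<^esub> v \<cdot>\<^bsub>\<A>\<^esub> u = Zero \<A> A Y"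
    using Comp_assoc[OF u(1) v(1) w(2)] cokernel_Zero[OF w(5,1,2)] assms(5) by simp
  then obtain x where x: "x \<in> homset \<A> X Y" "x \<cdot>\<^bsub>\<A>\<^esub> q = r \<cdot>\<^bsub>\<A>\<^esub> v"
    using cokernel_desc[OF u(5,1,2) Comp_hom[OF v(1) w(2)]] by blast
  \<comment> \<open>Since \<open>t\<close> kills \<open>v\<close>, it kills \<open>w\<close> as well
    and descends along \<open>r\<close>, which yields \<open>y\<close>.\<close>
  have "t \<cdot>\<^bsub>\<A>\<^esub> w = Zero \<A> A Z"
    using Comp_assoc[OF u(1) v(1,2)] cokernel_Zero[OF v(5,1,2)]
      Zero_Comp[OF homset_Obj(2)[OF v(2)] u(1)] assms(5) by simp
  then obtain y where y: "y \<in> homset \<A> Y Z" "y \<cdot>\<^bsub>\<A>\<^esub> r = t"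
    using cokernel_desc[OF w(5,1,2) v(2)] by blast
  have po: "is_pushout \<A> q v x r"
    using noether_pushout assms(2,3,5) v(1) x by blast
  have "admissible_monic \<E> v" using v(3) by (auto simp: admissible_monic_def)
  \<comment> \<open>In the swapped square \<open>v\<close> comes first and \<open>x\<close> is the
    side opposite to it, as the push-out axiom requires.\<close>
  then have "admissible_monic \<E> x" using is_pushout_swap[OF po] by (rule pushout_monic)
  then have xy: "short_exact \<A> \<E> X x Y y Z"
    using noether_cokernel[OF assms(4,2,3) x(1) y(1) x(2) y(2)] x(1) y(1)
    by (rule cokernel_of_admissible_monic)
  have pb: "is_pullback \<A> q v x r"
    by (rule noether_pullback[OF assms(4) xy u(2) w(2) x(2) y(2)])
  \<comment> \<open>Each morphism is determined by its own square, since \<open>q\<close> and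
    \<open>r\<close> are epic.\<close>
  have unique: "x' = x \<and> y' = y"
    if "x' \<in> homset \<A> X Y" "y' \<in> homset \<A> Y Z" "x' \<cdot>\<^bsub>\<A>\<^esub> q = r \<cdot>\<^bsub>\<A>\<^esub> v" "y' \<cdot>\<^bsub>\<A>\<^esub> r = t" for x' y'
    using that cokernel_epic[OF u(5,2) _ x(1)] cokernel_epic[OF w(5,2) _ y(1)] x(2) y(2) by simp
  show ?thesis
    \<comment> \<open>Removing the identities turns the upper left square into
      \<open>w = v \<cdot> u\<close> and the lower right one into
      \<open>y \<cdot> r = t\<close>.\<close>
    unfolding Let_def Ident_Comp[OF v(2)] Comp_Ident[OF w(1)] bicartesian_def
    using x y xy po pb unique assms(5) by blast
qed

end
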